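(* Let $a\ge b\ge c\ge 0$ be integers and $d=a+b+c$. Suppose that the following two conditions hold: (1) $d=6k+3$ for an integer $k$ such that $a<4k+2$; (2) among the numbers $a,b,c$, at least two are equal. Then the algebra $R_{a,b,c}=\Bbbk[x,y,z]/(x^d,y^d,z^d,x^ay^bz^c)$ fails the WLP.
   Context: $\Bbbk$ is a field of characteristic zero, and $\Bbbk[x,y,z]$ has the standard grading. A standard graded Artinian algebra $A$ has the weak Lefschetz property (WLP) if there is a linear form $\ell$ such that for all $i$ the multiplication map $\cdot\ell:A_i\to A_{i+1}$ has maximal rank (i.e. is injective or surjective); it fails the WLP otherwise. *)

theory Defs
  imports
    "HOL-Library.Poly_Mapping"
    "HOL-Library.Product_Plus"
    "HOL-Algebra.QuotRing"
    "HOL-Algebra.Algebraic_Closure_Type"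
begin

text \<open>
  Polynomials in three variables: the key \<open>(e1, e2, e3)\<close> stands for the monomial
  \<open>x^e1 y^e2 z^e3\<close>; exponents are added componentwise, so the multiplication of
  finitely supported maps (convolution) is multiplication of polynomials.
\<close>

type_synonym 'k poly3 = "(nat \<times> nat \<times> nat) \<Rightarrow>\<^sub>0 'k"

definition var_x :: "'k::comm_ring_1 poly3"
  where "var_x = Poly_Mapping.single (1, 0, 0) 1"

definition var_y :: "'k::comm_ring_1 poly3"
  where "var_y = Poly_Mapping.single (0, 1, 0) 1"

definition var_z :: "'k::comm_ring_1 poly3"
  where "var_z = Poly_Mapping.single (0, 0, 1) 1"

definition forms :: "nat \<Rightarrow> 'k::comm_ring_1 poly3 set"
  where "forms n = {p. Poly_Mapping.keys p \<subseteq> {(i, j, l). i + j + l = n}}"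

text \<open>The constant \<^const>\<open>ring_of_type_algebra\<close> turns a type class ring into a record with carrier \<^term>\<open>UNIV\<close>.\<close>

abbreviation poly3_ring :: "'k::comm_ring_1 poly3 ring"
  where "poly3_ring \<equiv> ring_of_type_algebra"

text \<open>
  The degree \<open>n\<close> component of the quotient by an ideal \<open>I\<close> is the image of the forms of degree
  \<open>n\<close> under the projection. This gives a grading of the quotient when \<open>I\<close> is homogeneous.
\<close>

definition quot_component :: "'k::comm_ring_1 poly3 set \<Rightarrow> nat \<Rightarrow> 'k poly3 set set"
  where "quot_component I n = (\<lambda>p. I +>\<^bsub>poly3_ring\<^esub> p) ` forms n"

text \<open>
  The weak Lefschetz property of a ring \<open>A\<close> whose homogeneous component of degree \<open>i\<close> is
  \<open>gr i\<close>. Standard grading and Artinianness are properties of the algebras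
  to which it is applied and are not part of the predicate.
\<close>

definition weak_Lefschetz :: "('a, 'b) ring_scheme \<Rightarrow> (nat \<Rightarrow> 'a set) \<Rightarrow> bool"
  where "weak_Lefschetz A gr \<longleftrightarrow>
    (\<exists>l \<in> gr 1. \<forall>i.
       inj_on (\<lambda>u. l \<otimes>\<^bsub>A\<^esub> u) (gr i) \<or>
       (\<lambda>u. l \<otimes>\<^bsub>A\<^esub> u) ` gr i = gr (i + 1))"

definition aci_ideal :: "nat \<Rightarrow> nat \<Rightarrow> nat \<Rightarrow> 'k::comm_ring_1 poly3 set"
  where "aci_ideal a b c = (let d = a + b + c in
    Idl\<^bsub>poly3_ring\<^esub> {var_x ^ d, var_y ^ d, var_z ^ d, var_x ^ a * var_y ^ b * var_z ^ c})"

definition aci_algebra :: "nat \<Rightarrow> nat \<Rightarrow> nat \<Rightarrow> 'k::comm_ring_1 poly3 set ring"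
  where "aci_algebra a b c = poly3_ring Quot aci_ideal a b c"

definition aci_component :: "nat \<Rightarrow> nat \<Rightarrow> nat \<Rightarrow> nat \<Rightarrow> 'k::comm_ring_1 poly3 set set"
  where "aci_component a b c = quot_component (aci_ideal a b c)"

end

theory Submission
  imports Defs
begin

text \<open>
  Multiplication by a linear form from degree \<open>8k + 2\<close> to degree \<open>8k + 3\<close> is neither injective
  nor surjective. Call the two equal exponents \<open>e\<close> and let \<open>x\<close>, \<open>y\<close> be the corresponding
  variables. If they occur in the linear form with nonzero coefficients, rescaling turns it into
  \<open>x + y + \<gamma>z\<close>, which is invariant under swapping \<open>x\<close> and \<open>y\<close>, as is the ideal. The two
  components have the same dimension, but because \<open>8k + 3\<close> is odd the invariant part is larger
  in degree \<open>8k + 2\<close> and the anti-invariant part is larger in degree \<open>8k + 3\<close>. Hence there is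
  an invariant form in the kernel and an anti-invariant functional that kills the image.
  If one of the two coefficients, say that of \<open>x\<close>, vanishes, multiplication preserves the
  exponent of \<open>x\<close>, and the parts with \<open>x\<close>-exponent \<open>0\<close> and \<open>d - 1\<close> provide such elements.
\<close>

section \<open>Underdetermined homogeneous linear systems\<close>

text \<open>Induction on the equations: two independent solutions of all equations but one have a
  nonzero combination that also solves the last one. The unknowns are the values on
  \<open>V\<close>, extended by zero.\<close>

lemma homogeneous_system_nontrivial_solution:
  fixes F :: "'y \<Rightarrow> ('x \<Rightarrow> 'k::field) \<Rightarrow> 'k"
  assumes "finite E" and "finite V" and "card E < card V"
    and lin: "\<And>y g s h. F y (\<lambda>x. g x + s * h x) = F y g + s * F y h"
  shows "\<exists>u. (\<exists>x\<in>V. u x \<noteq> 0) \<and> (\<forall>x. x \<notin> V \<longrightarrow> u x = 0) \<and> (\<forall>y\<in>E. F y u = 0)"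
  using assms(1-3)
proof (induction E arbitrary: V rule: finite_induct)
  case empty
  then obtain x0 where "x0 \<in> V" by fastforce
  then show ?case by (intro exI[of _ "\<lambda>x. if x = x0 then 1 else 0"]) auto
next
  case (insert y E)
  have smaller: "\<exists>u. (\<exists>x\<in>V - {x1}. u x \<noteq> 0) \<and> (\<forall>x. x \<notin> V - {x1} \<longrightarrow> u x = 0) \<and> (\<forall>y\<in>E. F y u = 0)"
    if "x1 \<in> V" for x1
    using insert.prems insert.hyps that by (intro insert.IH) auto
  from insert.prems obtain x0 where "x0 \<in> V" by fastforce
  from smaller[OF this] obtain g x1 where g: "x1 \<in> V" "g x1 \<noteq> 0" "\<forall>x. x \<notin> V \<longrightarrow> g x = 0"
    "\<forall>y\<in>E. F y g = 0" by auto
  \<comment> \<open>Removing the position \<open>x1\<close>, where \<open>g\<close> is nonzero,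
    makes \<open>h\<close> linearly independent of \<open>g\<close>.\<close>
  from smaller[OF g(1)] obtain h x2 where h: "x2 \<in> V" "h x2 \<noteq> 0" "h x1 = 0"
    "\<forall>x. x \<notin> V \<longrightarrow> h x = 0" "\<forall>y\<in>E. F y h = 0" by auto
  show ?case
  proof (cases "F y g = 0")
    case True
    with g show ?thesis by auto
  next
    case False
    define s where "s = - F y h / F y g"
    define v where "v = (\<lambda>x. h x + s * g x)"
    have "F z v = F z h + s * F z g" for z
      unfolding v_def by (rule lin)
    then have "\<forall>z\<in>insert y E. F z v = 0"
      using False g(4) h(5) by (auto simp: s_def)
    moreover have "\<exists>x\<in>V. v x \<noteq> 0"
      using g(1,2) h(1,2,3) by (cases "s = 0") (auto simp: v_def intro: bexI[of _ x1])
    moreover have "\<forall>x. x \<notin> V \<longrightarrow> v x = 0"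
      using g(3) h(4) by (simp add: v_def)
    ultimately show ?thesis by blast
  qed
qed

section \<open>Kernel and cokernel witnesses in terms of coefficients\<close>

text \<open>\<open>standard a b c i j m\<close>: the monomial \<open>x^i y^j z^m\<close> is not in the ideal of \<open>R_{a,b,c}\<close>.\<close>

definition standard :: "nat \<Rightarrow> nat \<Rightarrow> nat \<Rightarrow> nat \<Rightarrow> nat \<Rightarrow> nat \<Rightarrow> bool"
  where "standard a b c i j m \<longleftrightarrow>
    i < a + b + c \<and> j < a + b + c \<and> m < a + b + c \<and> \<not> (a \<le> i \<and> b \<le> j \<and> c \<le> m)"

text \<open>
  The coefficient of \<open>x^i y^j z^m\<close> in the product of \<open>\<alpha>x + \<beta>y + \<gamma>z\<close> with the polynomial that
  has coefficients \<open>u\<close>.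
\<close>

definition mult_coeff :: "'k::comm_ring_1 \<Rightarrow> 'k \<Rightarrow> 'k \<Rightarrow> (nat \<Rightarrow> nat \<Rightarrow> nat \<Rightarrow> 'k) \<Rightarrow> nat \<Rightarrow> nat \<Rightarrow> nat \<Rightarrow> 'k"
  where "mult_coeff \<alpha> \<beta> \<gamma> u i j m =
    \<alpha> * (if i = 0 then 0 else u (i - 1) j m) + \<beta> * (if j = 0 then 0 else u i (j - 1) m) +
    \<gamma> * (if m = 0 then 0 else u i j (m - 1))"

text \<open>Divisors of standard monomials are standard, so the equations involve only the class of
  \<open>u\<close> in the quotient; hence there is no support condition on \<open>u\<close>.\<close>

definition has_kernel :: "nat \<Rightarrow> nat \<Rightarrow> nat \<Rightarrow> 'k::comm_ring_1 \<Rightarrow> 'k \<Rightarrow> 'k \<Rightarrow> nat \<Rightarrow> bool"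
  where "has_kernel a b c \<alpha> \<beta> \<gamma> n \<longleftrightarrow> (\<exists>u.
    (\<exists>i j m. i + j + m = n \<and> standard a b c i j m \<and> u i j m \<noteq> 0) \<and>
    (\<forall>i j m. i + j + m = n + 1 \<longrightarrow> standard a b c i j m \<longrightarrow> mult_coeff \<alpha> \<beta> \<gamma> u i j m = 0))"

text \<open>Here \<open>\<phi> i j m\<close> is the value of a linear functional on the monomial x^i
  y^j z^m. The second clause makes it kill the ideal, the third makes it kill the product of the
  linear form with every monomial of degree \<open>n\<close>, standard or not.\<close>

definition has_cokernel :: "nat \<Rightarrow> nat \<Rightarrow> nat \<Rightarrow> 'k::comm_ring_1 \<Rightarrow> 'k \<Rightarrow> 'k \<Rightarrow> nat \<Rightarrow> bool"
  where "has_cokernel a b c \<alpha> \<beta> \<gamma> n \<longleftrightarrow> (\<exists>\<phi>.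
    (\<exists>i j m. i + j + m = n + 1 \<and> \<phi> i j m \<noteq> 0) \<and>
    (\<forall>i j m. \<not> standard a b c i j m \<longrightarrow> \<phi> i j m = 0) \<and>
    (\<forall>i j m. i + j + m = n \<longrightarrow>
      \<alpha> * \<phi> (i + 1) j m + \<beta> * \<phi> i (j + 1) m + \<gamma> * \<phi> i j (m + 1) = 0))"

lemma has_kernelI:
  assumes "i0 + j0 + m0 = n" "standard a b c i0 j0 m0" "u i0 j0 m0 \<noteq> 0"
    and "\<And>i j m. i + j + m = n + 1 \<Longrightarrow> standard a b c i j m \<Longrightarrow> mult_coeff \<alpha> \<beta> \<gamma> u i j m = 0"
  shows "has_kernel a b c \<alpha> \<beta> \<gamma> n"
  unfolding has_kernel_def using assms by blast

lemma has_cokernelI: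
  assumes "i0 + j0 + m0 = n + 1" "\<phi> i0 j0 m0 \<noteq> 0"
    and "\<And>i j m. \<not> standard a b c i j m \<Longrightarrow> \<phi> i j m = 0"
    and "\<And>i j m. i + j + m = n \<Longrightarrow>
      \<alpha> * \<phi> (i + 1) j m + \<beta> * \<phi> i (j + 1) m + \<gamma> * \<phi> i j (m + 1) = 0"
  shows "has_cokernel a b c \<alpha> \<beta> \<gamma> n"
  unfolding has_cokernel_def using assms by blast

lemma standard_swap: "standard b a c j i m = standard a b c i j m"
  by (auto simp: standard_def)

lemma standard_rotate: "standard c a b m i j = standard a b c i j m"
  by (auto simp: standard_def)

text \<open>When the first two exponents agree, this reduces a vanishing coefficient of y to a
  vanishing coefficient of x.\<close>

lemma has_kernel_swap:
  assumes "has_kernel a b c \<alpha> \<beta> \<gamma> n"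
  shows "has_kernel b a c \<beta> \<alpha> \<gamma> n"
proof -
  from assms obtain u i j m where u: "i + j + m = n" "standard a b c i j m" "u i j m \<noteq> 0"
    "\<And>i j m. i + j + m = n + 1 \<Longrightarrow> standard a b c i j m \<Longrightarrow> mult_coeff \<alpha> \<beta> \<gamma> u i j m = 0"
    unfolding has_kernel_def by blast
  have "mult_coeff \<beta> \<alpha> \<gamma> (\<lambda>j i m. u i j m) j i m = 0"
    if "j + i + m = n + 1" "standard b a c j i m" for i j m
    using u(4)[of i j m] that by (simp add: standard_swap mult_coeff_def add_ac)
  moreover have "j + i + m = n" "standard b a c j i m"
    using u by (auto simp: standard_swap)
  ultimately show ?thesis
    unfolding has_kernel_def using u(3) by (intro exI[of _ "\<lambda>j i m. u i j m"]) blast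
qed

text \<open>Serves to move a pair of equal exponents from the first two places to the last
  two.\<close>

lemma has_kernel_rotate:
  assumes "has_kernel a b c \<alpha> \<beta> \<gamma> n"
  shows "has_kernel c a b \<gamma> \<alpha> \<beta> n"
proof -
  from assms obtain u i j m where u: "i + j + m = n" "standard a b c i j m" "u i j m \<noteq> 0"
    "\<And>i j m. i + j + m = n + 1 \<Longrightarrow> standard a b c i j m \<Longrightarrow> mult_coeff \<alpha> \<beta> \<gamma> u i j m = 0"
    unfolding has_kernel_def by blast
  have "mult_coeff \<gamma> \<alpha> \<beta> (\<lambda>m i j. u i j m) m i j = 0"
    if "m + i + j = n + 1" "standard c a b m i j" for i j m
    using u(4)[of i j m] that by (simp add: standard_rotate mult_coeff_def add_ac)
  moreover have "m + i + j = n" "standard c a b m i j"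
    using u by (auto simp: standard_rotate)
  ultimately show ?thesis
    unfolding has_kernel_def using u(3) by (intro exI[of _ "\<lambda>m i j. u i j m"]) blast
qed

lemma has_cokernel_swap:
  assumes "has_cokernel a b c \<alpha> \<beta> \<gamma> n"
  shows "has_cokernel b a c \<beta> \<alpha> \<gamma> n"
proof -
  from assms obtain \<phi> i j m where \<phi>: "i + j + m = n + 1" "\<phi> i j m \<noteq> 0"
    "\<And>i j m. \<not> standard a b c i j m \<Longrightarrow> \<phi> i j m = 0"
    "\<And>i j m. i + j + m = n \<Longrightarrow>
      \<alpha> * \<phi> (i + 1) j m + \<beta> * \<phi> i (j + 1) m + \<gamma> * \<phi> i j (m + 1) = 0"
    unfolding has_cokernel_def by blast
  have "\<beta> * \<phi> i (j + 1) m + \<alpha> * \<phi> (i + 1) j m + \<gamma> * \<phi> i j (m + 1) = 0"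
    if "j + i + m = n" for i j m
    using \<phi>(4)[of i j m] that by (simp add: add_ac)
  moreover have "j + i + m = n + 1" using \<phi>(1) by simp
  moreover have "\<phi> i j m = 0" if "\<not> standard b a c j i m" for i j m
    using \<phi>(3) that by (simp add: standard_swap)
  ultimately show ?thesis
    unfolding has_cokernel_def using \<phi>(2) by (intro exI[of _ "\<lambda>j i m. \<phi> i j m"]) blast
qed

lemma has_cokernel_rotate:
  assumes "has_cokernel a b c \<alpha> \<beta> \<gamma> n"
  shows "has_cokernel c a b \<gamma> \<alpha> \<beta> n"
proof -
  from assms obtain \<phi> i j m where \<phi>: "i + j + m = n + 1" "\<phi> i j m \<noteq> 0"
    "\<And>i j m. \<not> standard a b c i j m \<Longrightarrow> \<phi> i j m = 0"
    "\<And>i j m. i + j + m = n \<Longrightarrow>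
      \<alpha> * \<phi> (i + 1) j m + \<beta> * \<phi> i (j + 1) m + \<gamma> * \<phi> i j (m + 1) = 0"
    unfolding has_cokernel_def by blast
  have "\<gamma> * \<phi> i j (m + 1) + \<alpha> * \<phi> (i + 1) j m + \<beta> * \<phi> i (j + 1) m = 0"
    if "m + i + j = n" for i j m
    using \<phi>(4)[of i j m] that by (simp add: add_ac)
  moreover have "m + i + j = n + 1" using \<phi>(1) by simp
  moreover have "\<phi> i j m = 0" if "\<not> standard c a b m i j" for i j m
    using \<phi>(3) that by (simp add: standard_rotate)
  ultimately show ?thesis
    unfolding has_cokernel_def using \<phi>(2) by (intro exI[of _ "\<lambda>m i j. \<phi> i j m"]) blast
qed

section \<open>Counting invariant and anti-invariant basis elements\<close>

lemma card_less_of_card_Diff_less: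
  assumes "finite A" "finite B" "card (A - B) < card (B - A)"
  shows "card A < card B"
proof -
  have "card A = card (A \<inter> B) + card (A - B)" "card B = card (A \<inter> B) + card (B - A)"
    using assms(1,2) by (metis card_Int_Diff, metis card_Int_Diff inf_commute)
  then show ?thesis using assms(3) by linarith
qed

text \<open>
  In degree \<open>n\<close> the third exponent is \<open>n - i - j\<close>, so these sets index bases of the invariant
  and of the anti-invariant part.
\<close>

definition sym_index :: "nat \<Rightarrow> nat \<Rightarrow> nat \<Rightarrow> (nat \<times> nat) set"
  where "sym_index e f n = {(i, j). i \<le> j \<and> i + j \<le> n \<and> standard e e f i j (n - i - j)}"

definition asym_index :: "nat \<Rightarrow> nat \<Rightarrow> nat \<Rightarrow> (nat \<times> nat) set"
  where "asym_index e f n = {(i, j). i < j \<and> i + j \<le> n \<and> standard e e f i j (n - i - j)}"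

lemma finite_sym_index: "finite (sym_index e f n)"
  by (rule finite_subset[of _ "{..n} \<times> {..n}"]) (auto simp: sym_index_def)

lemma finite_asym_index: "finite (asym_index e f n)"
  by (rule finite_subset[of _ "{..n} \<times> {..n}"]) (auto simp: asym_index_def)

context
  fixes e f k :: nat
  assumes sum: "2 * e + f = 6 * k + 3" and f_less: "f < 4 * k + 2"
begin

lemma f_pos: "f > 0"
  using sum by presburger

text \<open>Fix \<open>(i, j)\<close> and raise the exponent of z by one. Pairs appear only with
  z-exponent 0, that is \<open>i + j = 8*k+3\<close>, which gives at most \<open>2*k+1\<close> of
  them. Pairs disappear when z^d is reached (\<open>?S\<close>) or x^e y^e z^f is reached
  (\<open>?T\<close>); each family has \<open>k+1\<close> members, including its diagonal
  pair.\<close>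

lemma card_sym_index_less: "card (sym_index e f (8*k+3)) < card (sym_index e f (8*k+2))"
proof (rule card_less_of_card_Diff_less)
  let ?A = "sym_index e f (8*k+3)" and ?B = "sym_index e f (8*k+2)"
  let ?S = "(\<lambda>i. (i, 2*k - i)) ` {..k}" and ?T = "(\<lambda>t. (e + t, 2*k + e - t)) ` {..k}"
  have "x \<in> (\<lambda>j. (8*k+3 - j, j)) ` {4*k+2..6*k+2}" if "x \<in> ?A - ?B" for x
  proof -
    obtain i j where x: "x = (i, j)" by fastforce
    \<comment> \<open>If the z-exponent were positive, dividing by z would leave a standard monomial
      and put the pair into \<open>?B\<close>.\<close>
    have "i + j = 8*k+3 \<and> i \<le> j \<and> j \<le> 6*k+2"
      using that sum f_less by (auto simp: x sym_index_def standard_def)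
    then have "(i, j) = (8*k+3 - j, j) \<and> j \<in> {4*k+2..6*k+2}"
      by auto
    then show ?thesis unfolding x by blast
  qed
  then have "?A - ?B \<subseteq> (\<lambda>j. (8*k+3 - j, j)) ` {4*k+2..6*k+2}"
    by blast
  then have "card (?A - ?B) \<le> card {4*k+2..6*k+2}"
    by (rule surj_card_le[rotated]) simp
  then have A_B: "card (?A - ?B) \<le> 2*k+1"
    by simp
  have "(i, j) \<in> ?B - ?A" if "i + j = 2*k" "i \<le> j" for i j
  proof -
    \<comment> \<open>The z-exponent rises from d - 1 to d. The bound on \<open>f\<close> forces
      \<open>k < e\<close>, so \<open>i < e\<close> keeps the monomial of degree
      \<open>8*k+2\<close> standard.\<close>
    have "8*k+2 - i - j = 6*k+2" "8*k+3 - i - j = 6*k+3" "e + e + f = 6*k+3" "i < e"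
      using that sum f_less by linarith+
    then show ?thesis using that by (simp add: sym_index_def standard_def)
  qed
  moreover have "(i, j) \<in> ?B - ?A" if "i + j = 2*k + 2*e" "e \<le> i" "i \<le> j" for i j
  proof -
    \<comment> \<open>The z-exponent rises from f - 1 to f, while x and y already have exponents at
      least \<open>e\<close>.\<close>
    have "8*k+2 - i - j + 1 = f" "8*k+3 - i - j = f" "e + e + f = 6*k+3" "j < 6*k+3"
      using that sum f_less f_pos by linarith+
    then show ?thesis using that f_pos by (simp add: sym_index_def standard_def)
  qed
  ultimately have "?S \<union> ?T \<subseteq> ?B - ?A"
    by (intro Un_least image_subsetI) simp_all
  then have "card (?S \<union> ?T) \<le> card (?B - ?A)"
    by (intro card_mono finite_Diff finite_sym_index)
  moreover have "?S \<inter> ?T = {}"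
    using sum f_less by auto
  then have "card (?S \<union> ?T) = card ?S + card ?T"
    by (intro card_Un_disjoint) auto
  moreover have "card ?S = k + 1" "card ?T = k + 1"
    by (subst card_image; auto simp: inj_on_def)+
  ultimately show "card (?A - ?B) < card (?B - ?A)" using A_B by linarith
qed (rule finite_sym_index)+

text \<open>The same count without diagonal pairs. Each disappearing family shrinks to
  \<open>k\<close> members, whereas the appearing pairs have odd sum \<open>8*k+3\<close>, so none
  of them is diagonal and there are still \<open>2*k+1\<close>.\<close>

lemma card_asym_index_less: "card (asym_index e f (8*k+2)) < card (asym_index e f (8*k+3))"
proof (rule card_less_of_card_Diff_less)
  let ?A = "asym_index e f (8*k+2)" and ?B = "asym_index e f (8*k+3)"
  let ?S = "(\<lambda>i. (i, 2*k - i)) ` {..<k}" and ?T = "(\<lambda>t. (e + t, 2*k + e - t)) ` {..<k}"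
  have "x \<in> ?S \<union> ?T" if "x \<in> ?A - ?B" for x
  proof -
    obtain i j where x: "x = (i, j)" by fastforce
    have "(i + j = 2*k \<and> i < j) \<or> (i + j = 2*k + 2*e \<and> e \<le> i \<and> i < j)"
      using that sum f_less by (auto simp: x asym_index_def standard_def)
    then have "(i, j) = (i, 2*k - i) \<and> i < k \<or> (i, j) = (e + (i - e), 2*k + e - (i - e)) \<and> i - e < k"
      by auto
    then show ?thesis unfolding x by blast
  qed
  then have "?A - ?B \<subseteq> ?S \<union> ?T"
    by blast
  then have "card (?A - ?B) \<le> card (?S \<union> ?T)"
    by (intro card_mono) auto
  also have "\<dots> \<le> card ?S + card ?T"
    by (rule card_Un_le)
  also have "\<dots> \<le> k + k"
    by (intro add_mono order.trans[OF card_image_le]) auto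
  also have "\<dots> < card ((\<lambda>j. (8*k+3 - j, j)) ` {4*k+2..6*k+2})"
    by (subst card_image) (auto simp: inj_on_def)
  also have "\<dots> \<le> card (?B - ?A)"
  proof (intro card_mono finite_Diff finite_asym_index image_subsetI)
    fix j assume "j \<in> {4*k+2..6*k+2}"
    then have "4*k+2 \<le> j" "j \<le> 6*k+2" "e + e + f = 6*k+3" "8*k+3 - j < j" "8*k+3 - j < 6*k+3"
      using sum by auto
    then show "(8*k+3 - j, j) \<in> ?B - ?A"
      using f_pos by (simp add: asym_index_def standard_def)
  qed
  finally show "card (?A - ?B) < card (?B - ?A)" .
qed (rule finite_asym_index)+

section \<open>Witnesses when x and y both occur in the linear form\<close>

text \<open>For x + y + \<gamma>z a symmetric form has a symmetric product, so only the coefficients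
  with \<open>i \<le> j\<close> count, both as unknowns and as equations. By
  \<open>card_sym_index_less\<close> there are more unknowns than equations.\<close>

lemma has_kernel_nondegenerate:
  fixes \<alpha> \<beta> \<gamma> :: "'k::field"
  assumes "\<alpha> \<noteq> 0" "\<beta> \<noteq> 0"
  shows "has_kernel e e f \<alpha> \<beta> \<gamma> (8*k+2)"
proof -
  let ?X = "sym_index e f (8*k+2)" and ?Y = "sym_index e f (8*k+3)"
  define W :: "(nat \<times> nat \<Rightarrow> 'k) \<Rightarrow> nat \<Rightarrow> nat \<Rightarrow> 'k" where "W w i j = w (min i j, max i j)" for w i j
  define F :: "nat \<times> nat \<Rightarrow> (nat \<times> nat \<Rightarrow> 'k) \<Rightarrow> 'k"
    where "F = (\<lambda>(i, j) w. mult_coeff 1 1 \<gamma> (\<lambda>i j m. W w i j) i j (8*k+3 - i - j))"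
  have "F y (\<lambda>x. g x + s * h x) = F y g + s * F y h" for y g s h
    by (auto simp: F_def mult_coeff_def W_def algebra_simps split: prod.split)
  from homogeneous_system_nontrivial_solution[where F = F, OF finite_sym_index finite_sym_index card_sym_index_less this]
  obtain w i0 j0 where w0: "(i0, j0) \<in> ?X" "w (i0, j0) \<noteq> 0" and w: "\<And>y. y \<in> ?Y \<Longrightarrow> F y w = 0"
    by auto
  have W_swap: "W w i j = W w j i" for i j
    by (simp add: W_def min.commute max.commute)
  have zero: "mult_coeff 1 1 \<gamma> (\<lambda>i j m. W w i j) i j m = 0"
    if "i + j + m = 8*k+3" "standard e e f i j m" "i \<le> j" for i j m
  proof -
    have "m = 8*k+3 - i - j" using that by linarith
    with that have "(i, j) \<in> ?Y" by (auto simp: sym_index_def)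
    from w[OF this] show ?thesis
      using \<open>m = 8*k+3 - i - j\<close> by (simp add: F_def)
  qed
  have zero': "mult_coeff 1 1 \<gamma> (\<lambda>i j m. W w i j) i j m = 0"
    if "i + j + m = 8*k+3" "standard e e f i j m" for i j m
  proof (cases "i \<le> j")
    case True
    with that show ?thesis by (rule zero)
  next
    case False
    with that have "mult_coeff 1 1 \<gamma> (\<lambda>i j m. W w i j) j i m = 0"
      by (intro zero) (auto simp: standard_swap)
    then show ?thesis
      unfolding mult_coeff_def by (subst (1 2 3) W_swap) (simp add: add_ac)
  qed
  \<comment> \<open>These are the coefficients after substituting \<alpha>x for x and \<beta>y for
    y, which turns x + y + \<gamma>z into \<alpha>x + \<beta>y + \<gamma>z.\<close>
  define u where "u = (\<lambda>i j (m::nat). \<alpha> ^ i * \<beta> ^ j * W w i j)"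
  have "mult_coeff \<alpha> \<beta> \<gamma> u i j m = \<alpha> ^ i * \<beta> ^ j * mult_coeff 1 1 \<gamma> (\<lambda>i j m. W w i j) i j m" for i j m
    by (cases i; cases j) (auto simp: mult_coeff_def u_def algebra_simps)
  then have "mult_coeff \<alpha> \<beta> \<gamma> u i j m = 0" if "i + j + m = 8*k+3" "standard e e f i j m" for i j m
    using zero'[OF that] by simp
  moreover have "u i0 j0 (8*k+2 - i0 - j0) \<noteq> 0" "i0 + j0 + (8*k+2 - i0 - j0) = 8*k+2"
    "standard e e f i0 j0 (8*k+2 - i0 - j0)"
    using w0 assms by (auto simp: sym_index_def u_def W_def min_def max_def)
  ultimately show ?thesis
    by (intro has_kernelI[where u = u]) (auto simp: numeral_3_eq_3)
qed

text \<open>The transposed system for an antisymmetric functional: unknowns live in degree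
  \<open>8*k+3\<close> and equations in degree \<open>8*k+2\<close>, so
  \<open>card_asym_index_less\<close> supplies the surplus of unknowns.\<close>

lemma has_cokernel_nondegenerate:
  fixes \<alpha> \<beta> \<gamma> :: "'k::field"
  assumes "\<alpha> \<noteq> 0" "\<beta> \<noteq> 0"
  shows "has_cokernel e e f \<alpha> \<beta> \<gamma> (8*k+2)"
proof -
  let ?X = "asym_index e f (8*k+3)" and ?Y = "asym_index e f (8*k+2)"
  define W :: "(nat \<times> nat \<Rightarrow> 'k) \<Rightarrow> nat \<Rightarrow> nat \<Rightarrow> 'k"
    where "W w i j = (if i < j then w (i, j) else if j < i then - w (j, i) else 0)" for w i j
  define F :: "nat \<times> nat \<Rightarrow> (nat \<times> nat \<Rightarrow> 'k) \<Rightarrow> 'k"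
    where "F = (\<lambda>(i, j) w. W w (i + 1) j + W w i (j + 1) + \<gamma> * W w i j)"
  have "F y (\<lambda>x. g x + s * h x) = F y g + s * F y h" for y g s h
    by (auto simp: F_def W_def algebra_simps split: prod.split)
  from homogeneous_system_nontrivial_solution[where F = F, OF finite_asym_index finite_asym_index card_asym_index_less this]
  obtain w i0 j0 where w0: "(i0, j0) \<in> ?X" "w (i0, j0) \<noteq> 0" "\<And>x. x \<notin> ?X \<Longrightarrow> w x = 0"
    and w: "\<And>y. y \<in> ?Y \<Longrightarrow> F y w = 0"
    by auto
  have W_swap: "W w i j = - W w j i" for i j
    by (auto simp: W_def)
  have W_zero: "W w i j = 0" if "i + j + m = 8*k+3" "\<not> standard e e f i j m" for i j m
  proof -
    have m: "m = 8*k+3 - i - j" "m = 8*k+3 - j - i" using that by linarith+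
    then show ?thesis
      using that(2) standard_swap[of e e f i j m] w0(3)[of "(i, j)"] w0(3)[of "(j, i)"]
      by (auto simp: W_def asym_index_def)
  qed
  have zero: "W w (i + 1) j + W w i (j + 1) + \<gamma> * W w i j = 0"
    if "i + j + m = 8*k+2" "i < j" for i j m
  proof (cases "standard e e f i j m")
    case True
    have "m = 8*k+2 - i - j" using that by linarith
    with that True have "(i, j) \<in> ?Y" by (auto simp: asym_index_def)
    from w[OF this] show ?thesis by (simp add: F_def)
  next
    case False
    \<comment> \<open>Multiples of a nonstandard monomial are nonstandard, and the functional
      vanishes there.\<close>
    then have "\<not> standard e e f (i + 1) j m" "\<not> standard e e f i (j + 1) m" "\<not> standard e e f i j (m + 1)"
      by (auto simp: standard_def)
    then show ?thesis
      using that W_zero[of "i + 1" j m] W_zero[of i "j + 1" m] W_zero[of i j "m + 1"] by simp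
  qed
  have zero': "W w (i + 1) j + W w i (j + 1) + \<gamma> * W w i j = 0" if "i + j + m = 8*k+2" for i j m
  proof -
    consider "i < j" | "i = j" | "j < i" by linarith
    then show ?thesis
    proof cases
      case 1
      with that show ?thesis by (rule zero)
    next
      case 2
      \<comment> \<open>On the diagonal the x and y terms cancel by antisymmetry and the z term is
        zero, which is why only the equations with \<open>i < j\<close> were imposed.\<close>
      then show ?thesis by (simp add: W_def)
    next
      case 3
      with that have "W w (j + 1) i + W w j (i + 1) + \<gamma> * W w j i = 0"
        by (intro zero[of j i m]) auto
      then have "- W w i (j + 1) - W w (i + 1) j - \<gamma> * W w i j = 0"
        by (subst (asm) (1 2 3) W_swap) simp
      then have "- (W w (i + 1) j + W w i (j + 1) + \<gamma> * W w i j) = 0"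
        by (simp only: minus_add_distrib diff_conv_add_uminus add_ac)
      then show ?thesis by (simp only: neg_equal_0_iff_equal)
    qed
  qed
  \<comment> \<open>A functional rescales dually to a form, hence the division. The restriction to
    degree \<open>8*k+3\<close> makes it vanish on nonstandard monomials of every degree.\<close>
  define \<phi> where "\<phi> = (\<lambda>i j (m::nat). if i + j + m = 8*k+3 then W w i j / (\<alpha> ^ i * \<beta> ^ j) else 0)"
  have "\<alpha> * \<phi> (i + 1) j m + \<beta> * \<phi> i (j + 1) m + \<gamma> * \<phi> i j (m + 1) = 0"
    if "i + j + m = 8*k+2" for i j m
  proof -
    have "\<alpha> * \<phi> (i + 1) j m + \<beta> * \<phi> i (j + 1) m + \<gamma> * \<phi> i j (m + 1) =
      (W w (i + 1) j + W w i (j + 1) + \<gamma> * W w i j) / (\<alpha> ^ i * \<beta> ^ j)"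
      using that assms by (simp add: \<phi>_def field_simps)
    then show ?thesis using zero'[OF that] by simp
  qed
  moreover have "i0 + j0 + (8*k+3 - i0 - j0) = 8*k+3" "\<phi> i0 j0 (8*k+3 - i0 - j0) \<noteq> 0"
    using w0 assms by (auto simp: asym_index_def \<phi>_def W_def)
  moreover have "\<phi> i j m = 0" if "\<not> standard e e f i j m" for i j m
    using W_zero that by (simp add: \<phi>_def)
  ultimately show ?thesis
    by (intro has_cokernelI[where \<phi> = \<phi>]) (auto simp: numeral_3_eq_3)
qed

section \<open>Witnesses when the coefficient of x vanishes\<close>

text \<open>Take forms in y and z only. Exponents at most \<open>6*k+2\<close> leave
  \<open>4*k+3\<close> monomials y^j z^m in degree \<open>8*k+2\<close> but only
  \<open>4*k+2\<close> in degree \<open>8*k+3\<close>.\<close>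

lemma has_kernel_degenerate:
  fixes \<beta> \<gamma> :: "'k::field"
  shows "has_kernel e e f 0 \<beta> \<gamma> (8*k+2)"
proof -
  \<comment> \<open>The truncated \<open>j - 1\<close> is harmless, since the equations have
    \<open>j \<ge> 2*k+1\<close>.\<close>
  define F :: "nat \<Rightarrow> (nat \<Rightarrow> 'k) \<Rightarrow> 'k" where "F j w = \<beta> * w (j - 1) + \<gamma> * w j" for j w
  have "F y (\<lambda>x. g x + s * h x) = F y g + s * F y h" for y g s h
    by (auto simp: F_def algebra_simps)
  from homogeneous_system_nontrivial_solution[of "{2*k+1..6*k+2}" "{2*k..6*k+2}" F, OF _ _ _ this]
  obtain w j0 where w0: "2*k \<le> j0" "j0 \<le> 6*k+2" "w j0 \<noteq> 0"
    and w: "\<And>y. 2*k+1 \<le> y \<Longrightarrow> y \<le> 6*k+2 \<Longrightarrow> F y w = 0"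
    by auto
  define u where "u = (\<lambda>i j (m::nat). if i = (0::nat) then w j else 0)"
  have "mult_coeff 0 \<beta> \<gamma> u i j m = 0" if "i + j + m = 8*k+3" "standard e e f i j m" for i j m
    using that sum w[of j] by (auto simp: mult_coeff_def u_def standard_def F_def)
  moreover have "standard e e f 0 j0 (8*k+2 - j0)" "u 0 j0 (8*k+2 - j0) \<noteq> 0" "0 + j0 + (8*k+2 - j0) = 8*k+2"
    using w0 sum f_less by (auto simp: standard_def u_def)
  ultimately show ?thesis
    by (intro has_kernelI[where u = u]) (auto simp: numeral_3_eq_3)
qed

text \<open>Support the functional on x-exponent d - 1. The other two exponents then sum to
  \<open>2*k+1\<close>, which gives \<open>2*k+2\<close> unknowns against \<open>2*k+1\<close>
  equations.\<close>

lemma has_cokernel_degenerate: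
  fixes \<beta> \<gamma> :: "'k::field"
  shows "has_cokernel e e f 0 \<beta> \<gamma> (8*k+2)"
proof -
  define F :: "nat \<Rightarrow> (nat \<Rightarrow> 'k) \<Rightarrow> 'k" where "F j w = \<beta> * w (j + 1) + \<gamma> * w j" for j w
  have "F y (\<lambda>x. g x + s * h x) = F y g + s * F y h" for y g s h
    by (auto simp: F_def algebra_simps)
  from homogeneous_system_nontrivial_solution[of "{..2*k}" "{..2*k+1}" F, OF _ _ _ this]
  obtain w j0 where w0: "j0 \<le> 2*k+1" "w j0 \<noteq> 0"
    and w: "\<And>y. y \<le> 2*k \<Longrightarrow> F y w = 0"
    by auto
  define \<phi> where "\<phi> = (\<lambda>i j m. if i = 6*k+2 \<and> j + m = 2*k+1 then w j else 0)"
  have "0 * \<phi> (i + 1) j m + \<beta> * \<phi> i (j + 1) m + \<gamma> * \<phi> i j (m + 1) = 0"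
    if "i + j + m = 8*k+2" for i j m
    using that w[of j] by (auto simp: \<phi>_def F_def)
  moreover have "6*k+2 + j0 + (2*k+1 - j0) = 8*k+3" "\<phi> (6*k+2) j0 (2*k+1 - j0) \<noteq> 0"
    using w0 by (auto simp: \<phi>_def)
  \<comment> \<open>The support is standard: \<open>e + f \<ge> 3*k+2\<close> exceeds
    \<open>2*k+1\<close>, so x^e y^e z^f divides none of its monomials.\<close>
  moreover have "\<phi> i j m = 0" if "\<not> standard e e f i j m" for i j m
    using that sum f_less by (auto simp: \<phi>_def standard_def)
  ultimately show ?thesis
    by (intro has_cokernelI[where \<phi> = \<phi>]) (auto simp: numeral_3_eq_3)
qed

lemma has_kernel_sym: "has_kernel e e f \<alpha> \<beta> (\<gamma> :: 'k::field) (8*k+2)"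
  using has_kernel_nondegenerate has_kernel_degenerate has_kernel_swap by metis

lemma has_cokernel_sym: "has_cokernel e e f \<alpha> \<beta> (\<gamma> :: 'k::field) (8*k+2)"
  using has_cokernel_nondegenerate has_cokernel_degenerate has_cokernel_swap by metis

end

section \<open>Polynomials, the monomial ideal and its cosets\<close>

lemma poly_mapping_eq_sum_single:
  "p = (\<Sum>t\<in>Poly_Mapping.keys p. Poly_Mapping.single t (Poly_Mapping.lookup p t))"
proof (rule poly_mapping_eqI)
  fix t
  show "Poly_Mapping.lookup p t =
    Poly_Mapping.lookup (\<Sum>t\<in>Poly_Mapping.keys p. Poly_Mapping.single t (Poly_Mapping.lookup p t)) t"
    by (simp add: lookup_sum lookup_single when_def in_keys_iff)
qed

lemma single_power:
  "Poly_Mapping.single (t :: nat \<times> nat \<times> nat) (1 :: 'k::comm_ring_1) ^ n =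
    Poly_Mapping.single (n * fst t, n * fst (snd t), n * snd (snd t)) 1"
proof (induction n)
  case 0
  then show ?case by (simp flip: single_one zero_prod_def)
next
  case (Suc n)
  then show ?case by (simp add: mult_single plus_prod_def)
qed

lemma lookup_single_mult:
  fixes p :: "'t::comm_monoid_add \<Rightarrow>\<^sub>0 'k::comm_ring_1"
  shows "Poly_Mapping.lookup (Poly_Mapping.single s c * p) t =
    c * (\<Sum>q. Poly_Mapping.lookup p q when t = s + q)"
  by (simp add: lookup_mult lookup_single when_mult)

definition linear_form :: "'k::comm_ring_1 \<Rightarrow> 'k \<Rightarrow> 'k \<Rightarrow> 'k poly3"
  where "linear_form \<alpha> \<beta> \<gamma> = Poly_Mapping.single (1, 0, 0) \<alpha> +
    Poly_Mapping.single (0, 1, 0) \<beta> + Poly_Mapping.single (0, 0, 1) \<gamma>"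

lemma forms_1_eq_linear_form:
  assumes "l \<in> forms 1"
  obtains \<alpha> \<beta> \<gamma> where "l = linear_form \<alpha> \<beta> \<gamma>"
proof
  show "l = linear_form (Poly_Mapping.lookup l (1, 0, 0)) (Poly_Mapping.lookup l (0, 1, 0))
    (Poly_Mapping.lookup l (0, 0, 1))"
  proof (rule poly_mapping_eqI)
    fix t :: "nat \<times> nat \<times> nat"
    obtain i j m where t: "t = (i, j, m)" by (cases t) auto
    show "Poly_Mapping.lookup l t = Poly_Mapping.lookup (linear_form (Poly_Mapping.lookup l (1, 0, 0))
      (Poly_Mapping.lookup l (0, 1, 0)) (Poly_Mapping.lookup l (0, 0, 1))) t"
    proof (cases "i + j + m = 1")
      case True
      then have "t = (1, 0, 0) \<or> t = (0, 1, 0) \<or> t = (0, 0, 1)"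
        unfolding t by auto
      then show ?thesis
        by (auto simp: linear_form_def lookup_add lookup_single when_def)
    next
      case False
      then have "t \<notin> Poly_Mapping.keys l" using assms t by (auto simp: forms_def)
      moreover have "t \<noteq> (1, 0, 0)" "t \<noteq> (0, 1, 0)" "t \<noteq> (0, 0, 1)"
        using False t by auto
      ultimately show ?thesis
        by (simp add: linear_form_def lookup_add lookup_single when_def in_keys_iff)
    qed
  qed
qed

lemma lookup_linear_form_mult:
  fixes p :: "'k::comm_ring_1 poly3"
  shows "Poly_Mapping.lookup (linear_form \<alpha> \<beta> \<gamma> * p) (i, j, m) =
    mult_coeff \<alpha> \<beta> \<gamma> (\<lambda>i j m. Poly_Mapping.lookup p (i, j, m)) i j m"
proof -
  have "(i, j, m) = (1, 0, 0) + q \<longleftrightarrow> i \<noteq> 0 \<and> q = (i - 1, j, m)"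
    "(i, j, m) = (0, 1, 0) + q \<longleftrightarrow> j \<noteq> 0 \<and> q = (i, j - 1, m)"
    "(i, j, m) = (0, 0, 1) + q \<longleftrightarrow> m \<noteq> 0 \<and> q = (i, j, m - 1)" for q
    by (cases q; auto)+
  then show ?thesis
    by (simp add: linear_form_def mult_coeff_def distrib_right lookup_add lookup_single_mult)
qed

text \<open>Additive inverses are multiples by -1, and commutativity makes left multiples
  suffice.\<close>

lemma ideal_poly3_ringI:
  fixes K :: "'k::comm_ring_1 poly3 set"
  assumes "0 \<in> K" "\<And>p q. p \<in> K \<Longrightarrow> q \<in> K \<Longrightarrow> p + q \<in> K" "\<And>p r. p \<in> K \<Longrightarrow> r * p \<in> K"
  shows "ideal K poly3_ring"
proof (rule idealI)
  show "ring (poly3_ring :: 'k poly3 ring)" by (rule ring_from_type_algebra)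
  then interpret ring "poly3_ring :: 'k poly3 ring" .
  have neg: "\<ominus>\<^bsub>poly3_ring\<^esub> p = (- 1) * p" for p :: "'k poly3"
    by (rule minus_equality) (simp_all add: ring_of_type_algebra_def)
  show "subgroup K (add_monoid poly3_ring)"
  proof (rule add.subgroupI)
    show "\<ominus>\<^bsub>poly3_ring\<^esub> p \<in> K" if "p \<in> K" for p
      unfolding neg using that by (rule assms(3))
  qed (use assms in \<open>auto simp: ring_of_type_algebra_def\<close>)
qed (use assms in \<open>auto simp: ring_of_type_algebra_def mult.commute\<close>)

definition nonstandard_span :: "nat \<Rightarrow> nat \<Rightarrow> nat \<Rightarrow> 'k::comm_ring_1 poly3 set"
  where "nonstandard_span a b c = {p. \<forall>(i, j, m)\<in>Poly_Mapping.keys p. \<not> standard a b c i j m}"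

lemma nonstandard_span_iff:
  "p \<in> nonstandard_span a b c \<longleftrightarrow>
    (\<forall>i j m. standard a b c i j m \<longrightarrow> Poly_Mapping.lookup p (i, j, m) = 0)"
  by (simp add: nonstandard_span_def Ball_def in_keys_iff) blast

lemma ideal_nonstandard_span: "ideal (nonstandard_span a b c :: 'k::comm_ring_1 poly3 set) poly3_ring"
proof (rule ideal_poly3_ringI)
  fix p r :: "'k poly3" assume p: "p \<in> nonstandard_span a b c"
  have "\<not> standard a b c i j m" if t: "(i, j, m) \<in> Poly_Mapping.keys (r * p)" for i j m
  proof -
    have "(i, j, m) \<in> {s + q | s q. s \<in> Poly_Mapping.keys r \<and> q \<in> Poly_Mapping.keys p}"
      using t keys_mult[of r p] by blast
    then obtain i1 j1 m1 i2 j2 m2 where "i = i1 + i2" "j = j1 + j2" "m = m1 + m2"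
      "(i2, j2, m2) \<in> Poly_Mapping.keys p"
      by (auto simp: plus_prod_def)
    moreover from this have "\<not> standard a b c i2 j2 m2"
      using p by (auto simp: nonstandard_span_def)
    ultimately show ?thesis by (auto simp: standard_def)
  qed
  then show "r * p \<in> nonstandard_span a b c"
    by (auto simp: nonstandard_span_def)
qed (auto simp: nonstandard_span_iff lookup_add)

text \<open>A monomial ideal is spanned by the monomials divisible by one of its generators. This
  turns ideal membership into a condition on coefficients.\<close>

lemma aci_ideal_eq_nonstandard_span:
  "(aci_ideal a b c :: 'k::comm_ring_1 poly3 set) = nonstandard_span a b c"
proof
  interpret ring "poly3_ring :: 'k poly3 ring" by (rule ring_from_type_algebra)
  define d where "d = a + b + c"
  define G :: "'k poly3 set" where
    "G = {var_x ^ d, var_y ^ d, var_z ^ d, var_x ^ a * var_y ^ b * var_z ^ c}"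
  have G: "G = {Poly_Mapping.single (d, 0, 0) 1, Poly_Mapping.single (0, d, 0) 1,
      Poly_Mapping.single (0, 0, d) 1, Poly_Mapping.single (a, b, c) 1}"
    by (simp add: G_def var_x_def var_y_def var_z_def single_power mult_single)
  have I: "aci_ideal a b c = Idl\<^bsub>poly3_ring\<^esub> G"
    by (simp add: aci_ideal_def G_def d_def Let_def)
  have "G \<subseteq> nonstandard_span a b c"
    by (auto simp: G nonstandard_span_def standard_def d_def)
  then show "(aci_ideal a b c :: 'k poly3 set) \<subseteq> nonstandard_span a b c"
    unfolding I by (rule genideal_minimal[OF ideal_nonstandard_span])
  have G_carrier: "G \<subseteq> carrier poly3_ring"
    by (simp add: ring_of_type_algebra_def)
  interpret I: ideal "aci_ideal a b c :: 'k poly3 set" poly3_ring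
    unfolding I by (rule genideal_ideal[OF G_carrier])
  have G_I: "G \<subseteq> aci_ideal a b c"
    unfolding I by (rule genideal_self[OF G_carrier])
  have add: "p + q \<in> aci_ideal a b c" if "p \<in> aci_ideal a b c" "q \<in> aci_ideal a b c" for p q :: "'k poly3"
    using I.a_closed[OF that] by (simp add: ring_of_type_algebra_def)
  have mult: "r * p \<in> aci_ideal a b c" if "p \<in> aci_ideal a b c" for p r :: "'k poly3"
    using I.I_l_closed[OF that, of r] by (simp add: ring_of_type_algebra_def)
  have zero: "0 \<in> (aci_ideal a b c :: 'k poly3 set)"
    using I.zero_closed by (simp add: ring_of_type_algebra_def)
  have single: "Poly_Mapping.single (i, j, m) r \<in> aci_ideal a b c"
    if nonstandard: "\<not> standard a b c i j m" for i j m and r :: 'k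
  proof -
    \<comment> \<open>\<open>t\<close> is the exponent of a generator dividing the monomial and
      \<open>s\<close> that of the cofactor.\<close>
    have "\<exists>s t. (i, j, m) = s + t \<and> Poly_Mapping.single t 1 \<in> G"
    proof -
      consider "d \<le> i" | "d \<le> j" | "d \<le> m" | "a \<le> i" "b \<le> j" "c \<le> m"
        using nonstandard by (force simp: standard_def d_def)
      then show ?thesis
      proof cases
        case 1 then show ?thesis
          by (intro exI[of _ "(i - d, j, m)"] exI[of _ "(d, 0, 0)"]) (simp add: G)
      next
        case 2 then show ?thesis
          by (intro exI[of _ "(i, j - d, m)"] exI[of _ "(0, d, 0)"]) (simp add: G)
      next
        case 3 then show ?thesis
          by (intro exI[of _ "(i, j, m - d)"] exI[of _ "(0, 0, d)"]) (simp add: G)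
      next
        case 4 then show ?thesis
          by (intro exI[of _ "(i - a, j - b, m - c)"] exI[of _ "(a, b, c)"]) (simp add: G)
      qed
    qed
    then obtain s t where "(i, j, m) = s + t" "Poly_Mapping.single t (1 :: 'k) \<in> aci_ideal a b c"
      using G_I by blast
    then show ?thesis
      using mult[of "Poly_Mapping.single t (1 :: 'k)" "Poly_Mapping.single s r"] by (simp add: mult_single)
  qed
  show "nonstandard_span a b c \<subseteq> (aci_ideal a b c :: 'k poly3 set)"
  proof
    fix p :: "'k poly3" assume p: "p \<in> nonstandard_span a b c"
    have "(\<Sum>t\<in>T. Poly_Mapping.single t (Poly_Mapping.lookup p t)) \<in> aci_ideal a b c"
      if "finite T" "T \<subseteq> Poly_Mapping.keys p" for T
      using that
    proof (induction rule: finite_induct)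
      case (insert t T)
      then show ?case
        using p single[of "fst t" "fst (snd t)" "snd (snd t)"]
        by (auto simp: nonstandard_span_def intro!: add)
    qed (simp add: zero)
    from this[OF finite_keys order.refl] show "p \<in> aci_ideal a b c"
      by (simp flip: poly_mapping_eq_sum_single)
  qed
qed

lemma aci_coset_eq_iff:
  fixes p q :: "'k::comm_ring_1 poly3"
  shows "aci_ideal a b c +>\<^bsub>poly3_ring\<^esub> p = aci_ideal a b c +>\<^bsub>poly3_ring\<^esub> q \<longleftrightarrow>
    p - q \<in> nonstandard_span a b c"
proof -
  have coset: "aci_ideal a b c +>\<^bsub>poly3_ring\<^esub> p = {r. r - p \<in> nonstandard_span a b c}" for p :: "'k poly3"
    by (auto simp: aci_ideal_eq_nonstandard_span a_r_coset_def' ring_of_type_algebra_def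
      intro!: bexI[of _ "_ - p"])
  show ?thesis
    unfolding coset set_eq_iff
    \<comment> \<open>Equality of the two cosets is tested at \<open>p\<close>, which lies in its
      own coset.\<close>
    by (auto simp: nonstandard_span_iff lookup_minus dest: spec[of _ p])
qed

lemma aci_coset_mult:
  fixes p q :: "'k::comm_ring_1 poly3"
  shows "(aci_ideal a b c +>\<^bsub>poly3_ring\<^esub> p) \<otimes>\<^bsub>aci_algebra a b c\<^esub> (aci_ideal a b c +>\<^bsub>poly3_ring\<^esub> q) =
    aci_ideal a b c +>\<^bsub>poly3_ring\<^esub> (p * q)"
proof -
  interpret I: ideal "aci_ideal a b c :: 'k poly3 set" poly3_ring
    unfolding aci_ideal_eq_nonstandard_span by (rule ideal_nonstandard_span)
  show ?thesis
    using I.rcoset_mult_add[of p q] by (simp add: aci_algebra_def FactRing_def ring_of_type_algebra_def)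
qed

lemma finite_exponents: "finite {(i :: nat, j :: nat, m :: nat). i + j + m = n}"
  by (rule finite_subset[of _ "{..n} \<times> {..n} \<times> {..n}"]) auto

section \<open>From witnesses to the failure of injectivity and surjectivity\<close>

text \<open>The degree \<open>n\<close> part of \<open>u\<close> is a form \<open>p\<close> outside
  the ideal whose product with the linear form lies in the ideal, so \<open>p\<close> and 0 have
  different classes with the same image.\<close>

lemma not_inj_on_mult_if_has_kernel:
  fixes \<alpha> \<beta> \<gamma> :: "'k::comm_ring_1"
  assumes "has_kernel a b c \<alpha> \<beta> \<gamma> n"
  shows "\<not> inj_on (\<lambda>u. (aci_ideal a b c +>\<^bsub>poly3_ring\<^esub> linear_form \<alpha> \<beta> \<gamma>) \<otimes>\<^bsub>aci_algebra a b c\<^esub> u)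
    (aci_component a b c n)"
proof
  let ?coset = "\<lambda>p. aci_ideal a b c +>\<^bsub>poly3_ring\<^esub> (p :: 'k poly3)"
  assume inj: "inj_on (\<lambda>u. ?coset (linear_form \<alpha> \<beta> \<gamma>) \<otimes>\<^bsub>aci_algebra a b c\<^esub> u) (aci_component a b c n)"
  from assms obtain u i0 j0 m0 where u: "i0 + j0 + m0 = n" "standard a b c i0 j0 m0" "u i0 j0 m0 \<noteq> 0"
    "\<And>i j m. i + j + m = n + 1 \<Longrightarrow> standard a b c i j m \<Longrightarrow> mult_coeff \<alpha> \<beta> \<gamma> u i j m = 0"
    unfolding has_kernel_def by blast
  define p where "p = (\<Sum>(i, j, m) | i + j + m = n. Poly_Mapping.single (i, j, m) (u i j m))"
  have lookup_p: "Poly_Mapping.lookup p (i, j, m) = (if i + j + m = n then u i j m else 0)" for i j m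
  proof -
    have "Poly_Mapping.lookup p (i, j, m) =
      (\<Sum>t | fst t + fst (snd t) + snd (snd t) = n. if t = (i, j, m) then u i j m else 0)"
      unfolding p_def lookup_sum
      by (rule sum.cong) (auto simp: lookup_single when_def split: prod.splits)
    then show ?thesis
      using finite_exponents[of n] by (simp add: case_prod_unfold)
  qed
  have p_forms: "p \<in> forms n"
    by (auto simp: forms_def in_keys_iff lookup_p split: if_splits)
  have "mult_coeff \<alpha> \<beta> \<gamma> (\<lambda>i j m. Poly_Mapping.lookup p (i, j, m)) i j m = 0"
    if "standard a b c i j m" for i j m
  proof (cases "i + j + m = n + 1")
    case True
    then have "mult_coeff \<alpha> \<beta> \<gamma> (\<lambda>i j m. Poly_Mapping.lookup p (i, j, m)) i j m = mult_coeff \<alpha> \<beta> \<gamma> u i j m"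
      by (cases i; cases j; cases m) (auto simp: mult_coeff_def lookup_p)
    with u(4) True that show ?thesis by simp
  next
    case False
    \<comment> \<open>Away from degree \<open>n + 1\<close> the product has no terms, since
      \<open>p\<close> is homogeneous of degree \<open>n\<close>.\<close>
    then have "Suc i' + j + m \<noteq> n + 1 \<longleftrightarrow> i' + j + m \<noteq> n"
      "i + Suc i' + m \<noteq> n + 1 \<longleftrightarrow> i + i' + m \<noteq> n"
      "i + j + Suc i' \<noteq> n + 1 \<longleftrightarrow> i + j + i' \<noteq> n" for i'
      by auto
    with False show ?thesis
      by (cases i; cases j; cases m) (simp_all add: mult_coeff_def lookup_p)
  qed
  then have "linear_form \<alpha> \<beta> \<gamma> * p \<in> nonstandard_span a b c"
    by (simp add: nonstandard_span_iff lookup_linear_form_mult)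
  then have "?coset (linear_form \<alpha> \<beta> \<gamma> * p) = ?coset (linear_form \<alpha> \<beta> \<gamma> * 0)"
    by (simp add: aci_coset_eq_iff)
  moreover have "?coset p \<in> aci_component a b c n" "?coset 0 \<in> aci_component a b c n"
    using p_forms by (auto simp: aci_component_def quot_component_def forms_def)
  ultimately have "?coset p = ?coset 0"
    using inj by (auto simp: inj_on_def aci_coset_mult)
  then have "p \<in> nonstandard_span a b c"
    by (simp add: aci_coset_eq_iff)
  then show False
    using u(1-3) lookup_p[of i0 j0 m0] by (simp add: nonstandard_span_iff)
qed

text \<open>The linear extension \<open>\<Phi>\<close> of \<open>\<phi>\<close> kills the ideal and
  all multiples of the linear form by forms of degree \<open>n\<close>. A monomial on which it is
  nonzero therefore has a class outside the image.\<close>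

lemma not_surj_mult_if_has_cokernel:
  fixes \<alpha> \<beta> \<gamma> :: "'k::comm_ring_1"
  assumes "has_cokernel a b c \<alpha> \<beta> \<gamma> n"
  shows "(\<lambda>u. (aci_ideal a b c +>\<^bsub>poly3_ring\<^esub> linear_form \<alpha> \<beta> \<gamma>) \<otimes>\<^bsub>aci_algebra a b c\<^esub> u) `
    aci_component a b c n \<noteq> aci_component a b c (n + 1)"
proof
  let ?coset = "\<lambda>p. aci_ideal a b c +>\<^bsub>poly3_ring\<^esub> (p :: 'k poly3)"
  let ?l = "linear_form \<alpha> \<beta> \<gamma>"
  assume surj: "(\<lambda>u. ?coset ?l \<otimes>\<^bsub>aci_algebra a b c\<^esub> u) ` aci_component a b c n = aci_component a b c (n + 1)"
  from assms obtain \<phi> i0 j0 m0 where \<phi>: "i0 + j0 + m0 = n + 1" "\<phi> i0 j0 m0 \<noteq> 0"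
    "\<And>i j m. \<not> standard a b c i j m \<Longrightarrow> \<phi> i j m = 0"
    "\<And>i j m. i + j + m = n \<Longrightarrow>
      \<alpha> * \<phi> (i + 1) j m + \<beta> * \<phi> i (j + 1) m + \<gamma> * \<phi> i j (m + 1) = 0"
    unfolding has_cokernel_def by blast
  define T where "T = {(i :: nat, j :: nat, m :: nat). i + j + m = n + 1}"
  have T: "finite T" unfolding T_def by (rule finite_exponents)
  define \<Phi> :: "'k poly3 \<Rightarrow> 'k"
    where "\<Phi> p = (\<Sum>(i, j, m)\<in>T. Poly_Mapping.lookup p (i, j, m) * \<phi> i j m)" for p
  have \<Phi>_add: "\<Phi> (p + q) = \<Phi> p + \<Phi> q" for p q
    by (simp add: \<Phi>_def case_prod_unfold lookup_add distrib_right sum.distrib)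
  have \<Phi>_sum: "\<Phi> (sum g A) = (\<Sum>x\<in>A. \<Phi> (g x))" for g :: "nat \<times> nat \<times> nat \<Rightarrow> 'k poly3" and A
    by (induction A rule: infinite_finite_induct) (auto simp: \<Phi>_add, auto simp: \<Phi>_def)
  have \<Phi>_single: "\<Phi> (Poly_Mapping.single (i, j, m) r) = r * \<phi> i j m" if "i + j + m = n + 1" for i j m r
  proof -
    have "\<Phi> (Poly_Mapping.single (i, j, m) r) = (\<Sum>t\<in>T. if t = (i, j, m) then r * \<phi> i j m else 0)"
      unfolding \<Phi>_def by (rule sum.cong) (auto simp: lookup_single when_def split: if_splits)
    then show ?thesis using T that by (simp add: T_def)
  qed
  have "\<Phi> (?l * Poly_Mapping.single (i, j, m) r) = 0" if "i + j + m = n" for i j m r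
  proof -
    have "\<Phi> (?l * Poly_Mapping.single (i, j, m) r) =
        \<alpha> * r * \<phi> (i + 1) j m + \<beta> * r * \<phi> i (j + 1) m + \<gamma> * r * \<phi> i j (m + 1)"
      using that by (simp add: linear_form_def distrib_right mult_single \<Phi>_add \<Phi>_single)
    also have "\<dots> = r * (\<alpha> * \<phi> (i + 1) j m + \<beta> * \<phi> i (j + 1) m + \<gamma> * \<phi> i j (m + 1))"
      by (simp add: algebra_simps)
    finally show ?thesis using \<phi>(4)[OF that] by simp
  qed
  then have \<Phi>_mult: "\<Phi> (?l * u) = 0" if "u \<in> forms n" for u
    using that
    by (subst poly_mapping_eq_sum_single) (auto simp: sum_distrib_left \<Phi>_sum forms_def intro!: sum.neutral)
  have \<Phi>_ideal: "\<Phi> p = 0" if "p \<in> nonstandard_span a b c" for p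
  proof -
    have "Poly_Mapping.lookup p (i, j, m) * \<phi> i j m = 0" for i j m
      using that \<phi>(3) by (cases "standard a b c i j m") (auto simp: nonstandard_span_iff)
    then show ?thesis by (simp add: \<Phi>_def)
  qed
  let ?p = "Poly_Mapping.single (i0, j0, m0) (1 :: 'k)"
  have "?coset ?p \<in> aci_component a b c (n + 1)"
    using \<phi>(1) by (auto simp: aci_component_def quot_component_def forms_def)
  then obtain u where u: "u \<in> forms n" "?coset ?p = ?coset (?l * u)"
    unfolding surj[symmetric] by (auto simp: aci_component_def quot_component_def aci_coset_mult)
  then have "\<Phi> (?p - ?l * u) = 0"
    by (intro \<Phi>_ideal) (simp add: aci_coset_eq_iff)
  moreover have "\<Phi> ?p = \<Phi> (?p - ?l * u) + \<Phi> (?l * u)"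
    by (simp flip: \<Phi>_add)
  ultimately show False
    using \<phi>(1,2) \<Phi>_mult[OF u(1)] by (simp add: \<Phi>_single)
qed

theorem theorem6:
  fixes a b c d :: nat and k :: int
  assumes "a \<ge> b" and "b \<ge> c"
    and "d = a + b + c"
    and "int d = 6 * k + 3" and "int a < 4 * k + 2"
    and "a = b \<or> b = c \<or> a = c"
  shows "\<not> weak_Lefschetz (aci_algebra a b c :: 'k::field_char_0 poly3 set ring) (aci_component a b c)"
proof
  assume "weak_Lefschetz (aci_algebra a b c :: 'k poly3 set ring) (aci_component a b c)"
  then obtain L :: "'k poly3 set" where "L \<in> aci_component a b c 1" and
    L: "\<And>i. inj_on (\<lambda>u. L \<otimes>\<^bsub>aci_algebra a b c\<^esub> u) (aci_component a b c i) \<or>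
      (\<lambda>u. L \<otimes>\<^bsub>aci_algebra a b c\<^esub> u) ` aci_component a b c i = aci_component a b c (i + 1)"
    unfolding weak_Lefschetz_def by blast
  then obtain l where "l \<in> forms 1" "L = aci_ideal a b c +>\<^bsub>poly3_ring\<^esub> l"
    unfolding aci_component_def quot_component_def by blast
  then obtain \<alpha> \<beta> \<gamma> where l: "L = aci_ideal a b c +>\<^bsub>poly3_ring\<^esub> linear_form \<alpha> \<beta> \<gamma>"
    by (metis forms_1_eq_linear_form)
  define \<kappa> where "\<kappa> = nat k"
  \<comment> \<open>Since \<open>d\<close> is a natural number, \<open>6 * k + 3\<close> cannot be
    negative, so \<open>k\<close> can be replaced by the natural number
    \<open>\<kappa>\<close>.\<close>
  have "k \<ge> 0" using assms(4) by linarith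
  then have \<kappa>: "a + b + c = 6 * \<kappa> + 3" "a < 4 * \<kappa> + 2"
    using assms(3-5) by (auto simp: \<kappa>_def)
  have witnesses: "has_kernel a b c \<alpha> \<beta> \<gamma> (8 * \<kappa> + 2) \<and> has_cokernel a b c \<alpha> \<beta> \<gamma> (8 * \<kappa> + 2)"
  proof (cases "a = b")
    case True
    then have sum: "2 * a + c = 6 * \<kappa> + 3" "c < 4 * \<kappa> + 2"
      using \<kappa> assms(2) by simp_all
    show ?thesis
      unfolding True[symmetric] using has_kernel_sym[OF sum] has_cokernel_sym[OF sum] by (rule conjI)
  next
    case False
    \<comment> \<open>By the ordering, \<open>a = c\<close> would force \<open>a = b\<close> as
      well.\<close>
    then have "b = c" using assms by auto
    then have "2 * b + a = 6 * \<kappa> + 3" using \<kappa> by simp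
    then have "has_kernel b b a \<beta> \<gamma> \<alpha> (8 * \<kappa> + 2)" "has_cokernel b b a \<beta> \<gamma> \<alpha> (8 * \<kappa> + 2)"
      using \<kappa>(2) by (rule has_kernel_sym, rule has_cokernel_sym)
    \<comment> \<open>The witnesses were built for the variable order y, z, x; rotation returns to
      x, y, z.\<close>
    from has_kernel_rotate[OF this(1)] has_cokernel_rotate[OF this(2)] show ?thesis
      unfolding \<open>b = c\<close> by (rule conjI)
  qed
  show False
    using L[of "8 * \<kappa> + 2"] not_inj_on_mult_if_has_kernel[OF conjunct1[OF witnesses]]
      not_surj_mult_if_has_cokernel[OF conjunct2[OF witnesses]]
    unfolding l by (elim disjE) (erule notE, assumption)+
qed

end
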